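(* Let $\kappa>0$, $R>0$, and let $\boldsymbol J\in(L^2(B_R))^3$ be a source with compact support contained in $B_R$. Then $\boldsymbol J$ is nonradiating if and only if $\boldsymbol J\in\mathcal N_1(R)$.
   Context: $B_R=\{x\in\mathbb R^3:|x|<R\}$, $\kappa>0$ is the wavenumber, $g(x,y)=\frac{e^{\mathrm i\kappa|x-y|}}{4\pi|x-y|}$, and $\boldsymbol G(x,y)=[\boldsymbol I+\kappa^{-2}\nabla\nabla]g(x,y)$ is the $3\times3$ dyadic Green's tensor of Maxwell's equations ($\nabla\nabla$ is the Hessian). The electric field generated by $\boldsymbol J$ is $\boldsymbol E(x)=\int_{B_R}\boldsymbol G(x,y)\boldsymbol J(y)\,\mathrm dy$, the solution of $\nabla\times(\nabla\times\boldsymbol E)-\kappa^2\boldsymbol E=\boldsymbol J$ satisfying the Silver--Müller radiation condition. A source $\boldsymbol J$ with compact support contained in $B_R$ is called nonradiating if this $\boldsymbol E$ is identically zero outside $B_R$. Let $j_0$ be the spherical Bessel function of order $0$. A source $\boldsymbol J\in(L^2(B_R))^3$ belongs to the null space $\mathcal N_1(R)$ if $$\int_{B_R}\big[(\boldsymbol I+\kappa^{-2}\nabla_y\nabla_y)j_0(\kappa|x-y|)\big]\boldsymbol J(y)\,\mathrm dy=0\quad\text{for all }|x|>R,$$ where $\nabla_y\nabla_y$ is the Hessian in $y$. *)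

theory Defs
  imports "HOL-Analysis.Analysis"
begin

definition L2 :: "(real^3) set \<Rightarrow> (real^3 \<Rightarrow> complex) set" where
  "L2 S = {f. f \<in> borel_measurable (lebesgue_on S) \<and>
              integrable (lebesgue_on S) (\<lambda>y. (norm (f y))\<^sup>2)}"

definition L2_vec :: "(real^3) set \<Rightarrow> (real^3 \<Rightarrow> complex^3) set" where
  "L2_vec S = {J. \<forall>i. (\<lambda>y. J y $ i) \<in> L2 S}"

text \<open>
  A source on \<open>S\<close> is represented by a total function whose values outside \<open>S\<close> are ignored.
  The following is the support, in the whole space, of its extension by zero: the complement of
  the largest open set on which that extension vanishes almost everywhere. For bounded \<open>S\<close> it is
  always compact, but in general it is only contained in the closure of \<open>S\<close>.
\<close>

definition ess_support :: "(real^3) set \<Rightarrow> (real^3 \<Rightarrow> complex^3) \<Rightarrow> (real^3) set" where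
  "ess_support S J =
     {x. \<forall>U. open U \<and> x \<in> U \<longrightarrow> \<not> (AE y in lebesgue_on (S \<inter> U). J y = 0)}"

definition hessian :: "(real^3 \<Rightarrow> complex) \<Rightarrow> real^3 \<Rightarrow> complex^3^3" where
  "hessian f x = (\<chi> i j. frechet_derivative
     (\<lambda>z. frechet_derivative f (at z) (axis j 1)) (at x) (axis i 1))"

definition green_scalar :: "real \<Rightarrow> real^3 \<Rightarrow> real^3 \<Rightarrow> complex" where
  "green_scalar \<kappa> x y =
     exp (\<i> * complex_of_real (\<kappa> * norm (x - y))) / complex_of_real (4 * pi * norm (x - y))"

text \<open>
  Here \<open>[I + \<kappa>\<^sup>-\<^sup>2\<nabla>\<nabla>]g = g I + \<kappa>\<^sup>-\<^sup>2\<nabla>\<nabla>g\<close>, with the Hessian taken in \<open>x\<close>.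
  On the diagonal \<open>x = y\<close> the value carries no meaning.
\<close>

definition green_tensor :: "real \<Rightarrow> real^3 \<Rightarrow> real^3 \<Rightarrow> complex^3^3" where
  "green_tensor \<kappa> x y =
     mat (green_scalar \<kappa> x y) + (1 / \<kappa>\<^sup>2) *\<^sub>R hessian (\<lambda>z. green_scalar \<kappa> z y) x"

text \<open>
  For \<open>x\<close> outside the support of \<open>J\<close> the integrand below is absolutely integrable. At points of
  the support the kernel has a non-integrable singularity and the integral is not meant to give
  the field there; \<open>nonradiating\<close> does not evaluate it at such points.
\<close>

definition electric_field ::
  "real \<Rightarrow> real \<Rightarrow> (real^3 \<Rightarrow> complex^3) \<Rightarrow> real^3 \<Rightarrow> complex^3" where
  "electric_field \<kappa> R J x =
     integral\<^sup>L (lebesgue_on (ball 0 R)) (\<lambda>y. green_tensor \<kappa> x y *v J y)"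

definition nonradiating :: "real \<Rightarrow> real \<Rightarrow> (real^3 \<Rightarrow> complex^3) \<Rightarrow> bool" where
  "nonradiating \<kappa> R J \<longleftrightarrow> (\<forall>x. x \<notin> ball 0 R \<longrightarrow> electric_field \<kappa> R J x = 0)"

definition spherical_bessel_j0 :: "real \<Rightarrow> real" where
  "spherical_bessel_j0 t = (if t = 0 then 1 else sin t / t)"

definition j0_kernel :: "real \<Rightarrow> real^3 \<Rightarrow> real^3 \<Rightarrow> complex" where
  "j0_kernel \<kappa> x y = complex_of_real (spherical_bessel_j0 (\<kappa> * norm (x - y)))"

definition j0_tensor :: "real \<Rightarrow> real^3 \<Rightarrow> real^3 \<Rightarrow> complex^3^3" where
  "j0_tensor \<kappa> x y =
     mat (j0_kernel \<kappa> x y) + (1 / \<kappa>\<^sup>2) *\<^sub>R hessian (\<lambda>z. j0_kernel \<kappa> x z) y"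

definition null_space_N1 :: "real \<Rightarrow> real \<Rightarrow> (real^3 \<Rightarrow> complex^3) set" where
  "null_space_N1 \<kappa> R =
     {J \<in> L2_vec (ball 0 R). \<forall>x. norm x > R \<longrightarrow>
        integral\<^sup>L (lebesgue_on (ball 0 R)) (\<lambda>y. j0_tensor \<kappa> x y *v J y) = 0}"

end

theory Submission
  imports Defs "HOL-Complex_Analysis.Conformal_Mappings"
begin

text \<open>
  The proof follows a fixed direction \<open>\<omega>\<close> and writes \<open>x = r\<omega>\<close>, \<open>s = 1/r\<close>. Then
  \<open>|x - y| = \<delta>/s\<close> with \<open>\<delta> = \<surd>(1 - 2s\<omega>\<bullet>y + s\<^sup>2|y|\<^sup>2)\<close>, and both \<open>\<delta>\<close> and the normalised phase
  \<open>(\<delta> - 1)/s = (s|y|\<^sup>2 - 2\<omega>\<bullet>y)/(\<delta> + 1)\<close> are holomorphic in \<open>s\<close> as long as \<open>|s||y| < 1\<close>. Hence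
  the Green tensor factors as \<open>e\<^sup>i\<^sup>\<kappa>\<^sup>r/(4\<pi>r)\<close> times a tensor (\<open>ray_tensor\<close>) that extends holomorphically
  to complex \<open>s\<close>, in particular to the point \<open>s = 0\<close> at infinity (\<open>green_tensor_along_ray\<close>,
  \<open>ray_tensor_holomorphic\<close>). Integrating against a source supported in the closed ball of radius
  \<open>\<rho> < R\<close>, the field along the ray is \<open>E(r\<omega>) = e\<^sup>i\<^sup>\<kappa>\<^sup>r/(4\<pi>r) F(\<kappa>,\<omega>,1/r)\<close>, where \<open>F\<close> (\<open>ray_field\<close>) is
  holomorphic on the disc \<open>|s| < 1/\<rho>\<close>. This is the Atkinson-Wilcox expansion, obtained without
  expanding anything.
  
  Since \<open>sin t = (e\<^sup>i\<^sup>t - e\<^sup>-\<^sup>i\<^sup>t)/(2i)\<close>, the \<open>j\<^sub>0\<close> tensor is a multiple of the difference of the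
  outgoing (\<open>\<kappa>\<close>) and the incoming (\<open>-\<kappa>\<close>) Green tensor (\<open>j0_tensor_nth\<close>). So membership in the null
  space says that the outgoing and the incoming field of \<open>J\<close> coincide for \<open>|x| > R\<close>. Both directions
  now reduce to properties of \<open>F\<close>.
  
  If \<open>J\<close> is nonradiating, \<open>F(\<kappa>,\<omega>,s)\<close> vanishes for \<open>0 < s < 1/R\<close>, hence on the whole disc, for all
  \<open>\<omega>\<close>. Changing the sign of \<open>\<kappa>\<close> amounts to changing the signs of \<open>\<omega>\<close> and \<open>s\<close>:
  \<open>F(-\<kappa>,\<omega>,s) = F(\<kappa>,-\<omega>,-s)\<close> (\<open>ray_field_reversal\<close>). So the incoming field vanishes as well, and
  therefore the difference.
  
  Conversely, equality of the outgoing and the incoming field means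
  \<open>e\<^sup>2\<^sup>i\<^sup>\<kappa>\<^sup>/\<^sup>s F(\<kappa>,\<omega>,s) = F(-\<kappa>,\<omega>,s)\<close> for small real \<open>s > 0\<close>, and by analytic continuation on the punctured
  disc. On the imaginary half-axis \<open>s = it\<close> the exponential is \<open>e\<^sup>2\<^sup>\<kappa>\<^sup>/\<^sup>t\<close>, which blows up faster than any
  power of \<open>1/t\<close>, whereas a nonzero holomorphic function decays at most like a power of \<open>t\<close>. So
  \<open>F = 0\<close> (\<open>outgoing_eq_incoming_imp_zero\<close>), on a disc that contains \<open>1/r\<close> for every \<open>r \<ge> R\<close>.
\<close>

section \<open>Hessians of radial kernels\<close>

lemma has_derivative_dist_point:
  fixes x y :: "real^3"
  assumes "x \<noteq> y"
  shows "((\<lambda>z. norm (z - y)) has_derivative (\<lambda>h. (x - y) \<bullet> h / norm (x - y))) (at x)"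
proof -
  have "((\<lambda>z. z - y) has_derivative (\<lambda>h. h)) (at x)"
    by (auto intro!: derivative_eq_intros)
  moreover have "(norm has_derivative (\<lambda>h. h \<bullet> sgn (x - y))) (at (x - y))"
    using assms by (intro has_derivative_norm) simp
  ultimately have "((\<lambda>z. norm (z - y)) has_derivative (\<lambda>h. h \<bullet> sgn (x - y))) (at x)"
    by (rule has_derivative_compose)
  moreover have "(\<lambda>h. h \<bullet> sgn (x - y)) = (\<lambda>h. (x - y) \<bullet> h / norm (x - y))"
    by (auto simp: sgn_div_norm inner_commute divide_inverse)
  ultimately show ?thesis by simp
qed

lemma has_derivative_radial:
  fixes f :: "real \<Rightarrow> complex" and q :: complex and x y :: "real^3"
  assumes "(f has_vector_derivative norm (x - y) * q) (at (norm (x - y)))" and "x \<noteq> y"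
  shows "((\<lambda>z. f (norm (z - y))) has_derivative (\<lambda>h. of_real ((x - y) \<bullet> h) * q)) (at x)"
proof -
  have "((\<lambda>z. f (norm (z - y))) has_derivative
      (\<lambda>h. ((x - y) \<bullet> h / norm (x - y)) *\<^sub>R (norm (x - y) * q))) (at x)"
    using has_derivative_compose[OF has_derivative_dist_point[OF assms(2)]
        assms(1)[unfolded has_vector_derivative_def]] .
  then show ?thesis using assms(2) by (simp add: scaleR_conv_of_real)
qed

text \<open>
  The gradient of a radial function \<open>f(|z - y|)\<close> is \<open>q(|z - y|)(z - y)\<close> with \<open>q(t) = f'(t)/t\<close>, and the
  same rule applied to \<open>q\<close> gives the Hessian. Writing the derivatives as \<open>t q\<close> and \<open>t p\<close>
  keeps divisions by the distance out of the statement.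
\<close>

lemma hessian_radial:
  fixes f p q :: "real \<Rightarrow> complex" and x y :: "real^3"
  assumes f: "\<And>t. t > 0 \<Longrightarrow> (f has_vector_derivative t * q t) (at t)"
    and q: "\<And>t. t > 0 \<Longrightarrow> (q has_vector_derivative t * p t) (at t)"
    and "x \<noteq> y"
    and u: "\<And>z. z \<noteq> y \<Longrightarrow> u z = f (norm (z - y))"
  shows "hessian u x $ i $ j =
    (if i = j then q (norm (x - y)) else 0)
      + p (norm (x - y)) * of_real (x $ i - y $ i) * of_real (x $ j - y $ j)"
proof -
  have open_compl: "open (- {y})" by auto
  have grad: "frechet_derivative u (at z) (axis j 1)
      = q (norm (z - y)) * of_real (z $ j - y $ j)" if "z \<noteq> y" for z
  proof -
    have "(u has_derivative (\<lambda>h. of_real ((z - y) \<bullet> h) * q (norm (z - y)))) (at z)"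
      by (rule has_derivative_transform_within_open[OF has_derivative_radial open_compl])
        (use that f u in auto)
    then have "frechet_derivative u (at z) = (\<lambda>h. of_real ((z - y) \<bullet> h) * q (norm (z - y)))"
      using frechet_derivative_at by fastforce
    then show ?thesis by (simp add: inner_axis)
  qed
  have lin: "((\<lambda>z. complex_of_real (z $ j - y $ j)) has_derivative (\<lambda>h. of_real (h $ j))) (at x)"
    by (rule has_derivative_of_real)
      (auto intro!: derivative_eq_intros bounded_linear.has_derivative[OF bounded_linear_vec_nth])
  have "((\<lambda>z. q (norm (z - y)) * of_real (z $ j - y $ j)) has_derivative
      (\<lambda>h. q (norm (x - y)) * of_real (h $ j)
          + of_real ((x - y) \<bullet> h) * p (norm (x - y)) * of_real (x $ j - y $ j))) (at x)"
    using has_derivative_mult[OF has_derivative_radial[OF q \<open>x \<noteq> y\<close>] lin] \<open>x \<noteq> y\<close> by simp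
  then have "((\<lambda>z. frechet_derivative u (at z) (axis j 1)) has_derivative
      (\<lambda>h. q (norm (x - y)) * of_real (h $ j)
          + of_real ((x - y) \<bullet> h) * p (norm (x - y)) * of_real (x $ j - y $ j))) (at x)"
    by (rule has_derivative_transform_within_open[OF _ open_compl])
      (use grad \<open>x \<noteq> y\<close> in auto)
  then have "frechet_derivative (\<lambda>z. frechet_derivative u (at z) (axis j 1)) (at x) =
      (\<lambda>h. q (norm (x - y)) * of_real (h $ j)
          + of_real ((x - y) \<bullet> h) * p (norm (x - y)) * of_real (x $ j - y $ j))"
    using frechet_derivative_at by fastforce
  moreover have "(axis i 1 :: real^3) $ j = (if i = j then 1 else 0)"
    by (simp add: axis_def)
  ultimately show ?thesis
    by (simp add: hessian_def inner_axis mult_ac)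
qed

text \<open>
  The radial profile of the Green function. It is kept for both signs of \<open>\<kappa>\<close>: a negative
  wavenumber gives the incoming wave.
\<close>

definition spherical_wave :: "real \<Rightarrow> real \<Rightarrow> complex" where
  "spherical_wave \<kappa> t = exp (\<i> * complex_of_real (\<kappa> * t)) / complex_of_real (4 * pi * t)"

text \<open>
  These are the profiles \<open>q\<close> and \<open>p\<close> that \<open>hessian_radial\<close> requires for the spherical wave.
\<close>

definition wave_slope :: "real \<Rightarrow> real \<Rightarrow> complex" where
  "wave_slope \<kappa> t = (\<i> * \<kappa> / t - 1 / t\<^sup>2) * spherical_wave \<kappa> t"

definition wave_curvature :: "real \<Rightarrow> real \<Rightarrow> complex" where
  "wave_curvature \<kappa> t = (3 / t ^ 4 - 3 * \<i> * \<kappa> / t ^ 3 - \<kappa>\<^sup>2 / t\<^sup>2) * spherical_wave \<kappa> t"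

lemma spherical_wave_deriv:
  assumes "t > 0"
  shows "(spherical_wave \<kappa> has_vector_derivative t * wave_slope \<kappa> t) (at t)"
proof -
  have "((\<lambda>z. exp (\<i> * (of_real \<kappa> * z)) / (4 * of_real pi * z)) has_field_derivative
      of_real t * wave_slope \<kappa> t) (at (of_real t))"
    unfolding wave_slope_def spherical_wave_def using assms
    by (auto intro!: derivative_eq_intros simp: field_simps power2_eq_square)
  from has_vector_derivative_real_field[OF this] show ?thesis
    unfolding spherical_wave_def[abs_def] by simp
qed

lemma wave_slope_deriv:
  assumes "t > 0"
  shows "(wave_slope \<kappa> has_vector_derivative t * wave_curvature \<kappa> t) (at t)"
proof -
  have "((\<lambda>z. \<i> * of_real \<kappa> / z - 1 / z\<^sup>2) has_field_derivative
      2 / of_real t ^ 3 - \<i> * \<kappa> / of_real t ^ 2) (at (of_real t))"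
    using assms
    by (auto intro!: derivative_eq_intros simp: field_simps power2_eq_square power3_eq_cube)
  from has_vector_derivative_mult[OF has_vector_derivative_real_field[OF this]
      spherical_wave_deriv[OF assms, of \<kappa>]]
  have "(wave_slope \<kappa> has_vector_derivative
      (\<i> * \<kappa> / t - 1 / t\<^sup>2) * (t * wave_slope \<kappa> t)
        + (2 / t ^ 3 - \<i> * \<kappa> / t\<^sup>2) * spherical_wave \<kappa> t) (at t)"
    unfolding wave_slope_def[abs_def] by simp
  moreover have "(\<i> * \<kappa> / t - 1 / t\<^sup>2) * (t * (\<i> * \<kappa> / t - 1 / t\<^sup>2))
        + (2 / t ^ 3 - \<i> * \<kappa> / t\<^sup>2) = t * (3 / t ^ 4 - 3 * \<i> * \<kappa> / t ^ 3 - \<kappa>\<^sup>2 / t\<^sup>2)"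
  proof -
    have rational: "(i * k * W - W\<^sup>2) * (T * (i * k * W - W\<^sup>2)) + (2 * W ^ 3 - i * k * W\<^sup>2)
        = T * (3 * W ^ 4 - 3 * i * k * W ^ 3 - k\<^sup>2 * W\<^sup>2)"
      if "i * i = -1" "W * T = 1" for i k W T :: complex
    proof -
      have "(i * k * W - W\<^sup>2)\<^sup>2 = (i * i) * (k\<^sup>2 * W\<^sup>2) - 2 * i * k * W ^ 3 + W ^ 4"
        by (simp add: power2_eq_square power3_eq_cube power4_eq_xxxx algebra_simps)
      also have "\<dots> = W ^ 4 - 2 * i * k * W ^ 3 - k\<^sup>2 * W\<^sup>2"
        using that by simp
      finally have "(i * k * W - W\<^sup>2) * (T * (i * k * W - W\<^sup>2))
          = T * (W ^ 4 - 2 * i * k * W ^ 3 - k\<^sup>2 * W\<^sup>2)"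
        by (simp add: power2_eq_square[of "i * k * W - W\<^sup>2"] mult.left_commute[of _ T])
      moreover have "2 * W ^ 3 - i * k * W\<^sup>2 = (W * T) * (2 * W ^ 3 - i * k * W\<^sup>2)"
        using that by simp
      then have "2 * W ^ 3 - i * k * W\<^sup>2 = T * (2 * W ^ 4 - i * k * W ^ 3)"
        by (simp add: power2_eq_square power3_eq_cube power4_eq_xxxx algebra_simps)
      ultimately have "(i * k * W - W\<^sup>2) * (T * (i * k * W - W\<^sup>2)) + (2 * W ^ 3 - i * k * W\<^sup>2)
          = T * (W ^ 4 - 2 * i * k * W ^ 3 - k\<^sup>2 * W\<^sup>2) + T * (2 * W ^ 4 - i * k * W ^ 3)"
        by (simp only:)
      then show ?thesis by (simp add: algebra_simps)
    qed
    show ?thesis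
      using rational[of \<i> "1 / t" t \<kappa>] assms by (simp add: power_divide)
  qed
  then have "(\<i> * \<kappa> / t - 1 / t\<^sup>2) * (t * ((\<i> * \<kappa> / t - 1 / t\<^sup>2) * spherical_wave \<kappa> t))
        + (2 / t ^ 3 - \<i> * \<kappa> / t\<^sup>2) * spherical_wave \<kappa> t = t * wave_curvature \<kappa> t"
    unfolding wave_curvature_def mult.assoc[symmetric] by (simp only: distrib_right[symmetric] of_real_divide of_real_power of_real_numeral of_real_1)
  ultimately show ?thesis
    unfolding wave_slope_def by (simp only: of_real_divide of_real_power of_real_numeral of_real_1)
qed

lemma green_tensor_nth:
  assumes "x \<noteq> y"
  shows "green_tensor \<kappa> x y $ i $ j =
    (if i = j then spherical_wave \<kappa> (norm (x - y)) + wave_slope \<kappa> (norm (x - y)) / \<kappa>\<^sup>2 else 0)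
      + wave_curvature \<kappa> (norm (x - y)) / \<kappa>\<^sup>2 * of_real (x $ i - y $ i) * of_real (x $ j - y $ j)"
proof -
  have green_wave: "green_scalar \<kappa> z y = spherical_wave \<kappa> (norm (z - y))" for z
    by (simp add: green_scalar_def spherical_wave_def)
  have "hessian (\<lambda>z. green_scalar \<kappa> z y) x $ i $ j =
    (if i = j then wave_slope \<kappa> (norm (x - y)) else 0)
      + wave_curvature \<kappa> (norm (x - y)) * of_real (x $ i - y $ i) * of_real (x $ j - y $ j)"
    by (rule hessian_radial[where f = "spherical_wave \<kappa>"])
      (use assms in \<open>simp_all add: spherical_wave_deriv wave_slope_deriv green_wave\<close>)
  moreover have "green_tensor \<kappa> x y $ i $ j =
      (if i = j then spherical_wave \<kappa> (norm (x - y)) else 0)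
        + hessian (\<lambda>z. green_scalar \<kappa> z y) x $ i $ j / \<kappa>\<^sup>2"
    by (simp add: green_tensor_def mat_def green_wave
        scaleR_conv_of_real[where 'a=complex])
  ultimately show ?thesis by (simp add: add_divide_distrib)
qed

text \<open>
  This is \<open>sin t = (e\<^sup>i\<^sup>t - e\<^sup>-\<^sup>i\<^sup>t)/(2i)\<close>, read as a relation between radial profiles: away from the
  diagonal, \<open>j\<^sub>0(\<kappa>t)\<close> is a combination of the two spherical waves. The tensors are linear in the
  profile, and for a radial kernel it makes no difference in which variable the Hessian is taken.
\<close>

lemma j0_tensor_nth:
  assumes "x \<noteq> y" "\<kappa> > 0"
  shows "j0_tensor \<kappa> x y $ i $ j =
    2 * pi / (\<i> * \<kappa>) * (green_tensor \<kappa> x y $ i $ j - green_tensor (-\<kappa>) x y $ i $ j)"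
proof -
  define c where "c = 2 * pi / (\<i> * \<kappa>)"
  have kernel: "j0_kernel \<kappa> x z = c * (spherical_wave \<kappa> (norm (z - x)) - spherical_wave (-\<kappa>) (norm (z - x)))"
    if "z \<noteq> x" for z
  proof -
    define r where "r = norm (z - x)"
    have "r > 0" using that by (simp add: r_def)
    have "exp (\<i> * of_real (\<kappa> * r)) - exp (\<i> * of_real (-\<kappa> * r)) = 2 * \<i> * of_real (sin (\<kappa> * r))"
    proof -
      have "complex_of_real (sin (\<kappa> * r)) = sin (of_real (\<kappa> * r))"
        by (rule sin_of_real[symmetric])
      also have "\<dots> = (exp (\<i> * of_real (\<kappa> * r)) - exp (- (\<i> * of_real (\<kappa> * r)))) / (2 * \<i>)"
        by (rule sin_exp_eq)
      finally show ?thesis by (simp add: field_simps)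
    qed
    then have "spherical_wave \<kappa> r - spherical_wave (-\<kappa>) r
        = 2 * \<i> * of_real (sin (\<kappa> * r)) / of_real (4 * pi * r)"
      unfolding spherical_wave_def by (simp add: diff_divide_distrib[symmetric])
    then have "c * (spherical_wave \<kappa> r - spherical_wave (-\<kappa>) r) = of_real (sin (\<kappa> * r) / (\<kappa> * r))"
      using \<open>r > 0\<close> \<open>\<kappa> > 0\<close> by (simp add: c_def field_simps)
    moreover have "j0_kernel \<kappa> x z = of_real (sin (\<kappa> * r) / (\<kappa> * r))"
      using \<open>r > 0\<close> \<open>\<kappa> > 0\<close>
      by (simp add: j0_kernel_def spherical_bessel_j0_def r_def norm_minus_commute[of x z])
    ultimately show ?thesis by (simp add: r_def)
  qed
  have deriv: "((\<lambda>t. c * (a \<kappa> t - a (-\<kappa>) t)) has_vector_derivative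
      of_real t * (c * (b \<kappa> t - b (-\<kappa>) t))) (at t)"
    if "\<And>k. (a k has_vector_derivative of_real t * b k t) (at t)"
    for a b :: "real \<Rightarrow> real \<Rightarrow> complex" and t
    by (rule has_vector_derivative_eq_rhs[OF has_vector_derivative_mult_right
        [OF has_vector_derivative_diff[OF that that]]]) (simp add: algebra_simps)
  define w v d where "w = c * (wave_slope \<kappa> (norm (x - y)) - wave_slope (-\<kappa>) (norm (x - y)))"
    and "v = c * (wave_curvature \<kappa> (norm (x - y)) - wave_curvature (-\<kappa>) (norm (x - y)))"
    and "d = complex_of_real (x $ i - y $ i) * of_real (x $ j - y $ j)"
  have "hessian (\<lambda>z. j0_kernel \<kappa> x z) y $ i $ j =
    (if i = j then c * (wave_slope \<kappa> (norm (y - x)) - wave_slope (-\<kappa>) (norm (y - x))) else 0)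
      + c * (wave_curvature \<kappa> (norm (y - x)) - wave_curvature (-\<kappa>) (norm (y - x)))
          * of_real (y $ i - x $ i) * of_real (y $ j - x $ j)"
    by (rule hessian_radial[where f = "\<lambda>t. c * (spherical_wave \<kappa> t - spherical_wave (-\<kappa>) t)"
          and q = "\<lambda>t. c * (wave_slope \<kappa> t - wave_slope (-\<kappa>) t)"
          and p = "\<lambda>t. c * (wave_curvature \<kappa> t - wave_curvature (-\<kappa>) t)"])
      (use assms kernel in \<open>auto intro!: deriv spherical_wave_deriv wave_slope_deriv\<close>)
  moreover have "of_real (y $ i - x $ i) * of_real (y $ j - x $ j) = d"
    by (simp add: d_def algebra_simps)
  ultimately have hess: "hessian (\<lambda>z. j0_kernel \<kappa> x z) y $ i $ j = (if i = j then w else 0) + v * d"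
    unfolding w_def v_def by (simp only: norm_minus_commute[of y x] mult.assoc)
  have "j0_tensor \<kappa> x y $ i $ j =
      (if i = j then j0_kernel \<kappa> x y else 0) + hessian (\<lambda>z. j0_kernel \<kappa> x z) y $ i $ j / \<kappa>\<^sup>2"
    by (simp add: j0_tensor_def mat_def scaleR_conv_of_real[where 'a=complex])
  also have "\<dots> = (if i = j then j0_kernel \<kappa> x y + w / \<kappa>\<^sup>2 else 0) + v * d / \<kappa>\<^sup>2"
    unfolding hess by (simp add: add_divide_distrib)
  also have "j0_kernel \<kappa> x y = c * (spherical_wave \<kappa> (norm (x - y)) - spherical_wave (-\<kappa>) (norm (x - y)))"
    using kernel[of y] assms(1) by (simp only: norm_minus_commute[of y x] not_sym)
  also have "(if i = j then \<dots> + w / \<kappa>\<^sup>2 else 0) + v * d / \<kappa>\<^sup>2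
      = c * (green_tensor \<kappa> x y $ i $ j - green_tensor (-\<kappa>) x y $ i $ j)"
    unfolding green_tensor_nth[OF \<open>x \<noteq> y\<close>] mult.assoc d_def[symmetric] w_def v_def
    by (simp add: ring_distribs diff_divide_distrib)
  finally show ?thesis by (simp add: c_def)
qed

section \<open>The Green tensor along a ray\<close>

text \<open>
  For \<open>s = 1/r\<close> this is \<open>|r\<omega> - y|/r\<close>.
\<close>

definition ray_distance :: "real^3 \<Rightarrow> complex \<Rightarrow> real^3 \<Rightarrow> complex" where
  "ray_distance \<omega> s y = csqrt (1 - 2 * s * of_real (\<omega> \<bullet> y) + s\<^sup>2 * of_real ((norm y)\<^sup>2))"

text \<open>
  For \<open>s = 1/r\<close> this is \<open>|r\<omega> - y| - r\<close>. The form \<open>(\<delta> - 1)/s\<close>, where \<open>\<delta>\<close> is the ray distance, has been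
  rationalised so that the singularity at \<open>s = 0\<close> disappears.
\<close>

definition ray_phase :: "real^3 \<Rightarrow> complex \<Rightarrow> real^3 \<Rightarrow> complex" where
  "ray_phase \<omega> s y = (s * of_real ((norm y)\<^sup>2) - 2 * of_real (\<omega> \<bullet> y)) / (ray_distance \<omega> s y + 1)"

text \<open>
  The bracket contains the entries of \<open>g\<^sup>-\<^sup>1(g I + \<kappa>\<^sup>-\<^sup>2\<nabla>\<nabla>g)\<close> in terms of \<open>s/\<delta> = 1/|x - y|\<close> and of
  the unit vector \<open>(\<omega> - sy)/\<delta> = (x - y)/|x - y|\<close>, where \<open>\<delta>\<close> is the ray distance and \<open>x = r\<omega>\<close>.
\<close>

definition ray_tensor :: "real \<Rightarrow> real^3 \<Rightarrow> complex \<Rightarrow> real^3 \<Rightarrow> complex^3^3" where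
  "ray_tensor \<kappa> \<omega> s y = (\<chi> i j.
     exp (\<i> * \<kappa> * ray_phase \<omega> s y) / ray_distance \<omega> s y *
     (of_bool (i = j) * (1 + (\<i> * \<kappa> * (s / ray_distance \<omega> s y) - (s / ray_distance \<omega> s y)\<^sup>2) / \<kappa>\<^sup>2)
      + (3 * (s / ray_distance \<omega> s y)\<^sup>2 - 3 * \<i> * \<kappa> * (s / ray_distance \<omega> s y) - \<kappa>\<^sup>2) / \<kappa>\<^sup>2
        * ((of_real (\<omega> $ i) - s * of_real (y $ i)) / ray_distance \<omega> s y)
        * ((of_real (\<omega> $ j) - s * of_real (y $ j)) / ray_distance \<omega> s y)))"

text \<open>
  The point \<open>r\<omega>\<close> is also \<open>(-r)(-\<omega>)\<close>. Passing to the second description leaves the ray distance alone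
  and negates the phase, the reciprocal distance and the direction vector; in the tensor, this is
  the effect of replacing \<open>\<kappa>\<close> by \<open>-\<kappa>\<close>.
\<close>

lemma ray_tensor_reversal: "ray_tensor (-\<kappa>) \<omega> s y = ray_tensor \<kappa> (-\<omega>) (-s) y"
proof -
  have "ray_distance (-\<omega>) (-s) y = ray_distance \<omega> s y"
    by (simp add: ray_distance_def)
  moreover from this have "ray_phase (-\<omega>) (-s) y = - ray_phase \<omega> s y"
    by (simp add: ray_phase_def minus_divide_left)
  moreover have "of_real ((-\<omega>) $ k) - (-s) * of_real (y $ k) = - (of_real (\<omega> $ k) - s * of_real (y $ k))" for k
    by simp
  ultimately show ?thesis
    unfolding ray_tensor_def vec_eq_iff vec_lambda_beta
    by (simp only: minus_divide_left[symmetric] mult_minus_left mult_minus_right minus_minus power2_minus of_real_minus) simp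
qed

text \<open>
  The radicand is \<open>(1 - s\<zeta>)(1 - s\<zeta>')\<close> for two conjugate numbers of modulus \<open>|y|\<close>, so both factors lie
  in the right half plane and the product avoids the branch cut of the square root. The proof checks
  this in real coordinates: a real radicand forces \<open>s\<close> to be real or \<open>\<omega>\<bullet>y = |y|\<^sup>2 Re s\<close>, and it is positive
  in both cases.
\<close>

lemma quadratic_notin_nonpos_Reals:
  fixes \<omega> y :: "real^3"
  assumes "norm \<omega> = 1" "cmod s * norm y < 1"
  shows "1 - 2 * s * of_real (\<omega> \<bullet> y) + s\<^sup>2 * of_real ((norm y)\<^sup>2) \<notin> \<real>\<^sub>\<le>\<^sub>0"
proof
  define a b where "a = \<omega> \<bullet> y" and "b = norm y"
  have a: "\<bar>a\<bar> \<le> b"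
    using Cauchy_Schwarz_ineq2[of \<omega> y] assms(1) by (simp add: a_def b_def)
  obtain u v where s: "s = Complex u v" by (cases s)
  have "(cmod s * b)\<^sup>2 < 1"
    using assms(2) by (simp add: b_def power_less_one_iff abs_square_less_1)
  then have small: "b\<^sup>2 * (u\<^sup>2 + v\<^sup>2) < 1"
    by (simp add: s cmod_power2 power_mult_distrib mult.commute)
  assume "1 - 2 * s * of_real (\<omega> \<bullet> y) + s\<^sup>2 * of_real ((norm y)\<^sup>2) \<in> \<real>\<^sub>\<le>\<^sub>0"
  then have im: "2 * v * (b\<^sup>2 * u - a) = 0" and re: "1 - 2 * u * a + (u\<^sup>2 - v\<^sup>2) * b\<^sup>2 \<le> 0"
    unfolding complex_nonpos_Reals_iff a_def[symmetric] b_def[symmetric]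
    by (auto simp: s power2_eq_square algebra_simps)
  from im consider "v = 0" | "a = b\<^sup>2 * u" by fastforce
  then show False
  proof cases
    case 1
    have "\<bar>u * b\<bar> < 1"
      using small 1 by (simp add: abs_square_less_1[symmetric] power_mult_distrib mult.commute)
    then have "0 < (1 - \<bar>u\<bar> * b)\<^sup>2" using a by (simp add: abs_mult)
    also have "\<dots> = 1 - 2 * (\<bar>u\<bar> * b) + u\<^sup>2 * b\<^sup>2"
      by (simp add: power2_eq_square algebra_simps abs_mult_self_eq)
    also have "\<dots> \<le> 1 - 2 * u * a + u\<^sup>2 * b\<^sup>2"
    proof -
      have "u * a \<le> \<bar>u\<bar> * \<bar>a\<bar>" by (metis abs_ge_self abs_mult)
      also have "\<dots> \<le> \<bar>u\<bar> * b" using a by (simp add: mult_left_mono)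
      finally show ?thesis by simp
    qed
    finally show False using re 1 by simp
  next
    case 2
    then have "1 - b\<^sup>2 * (u\<^sup>2 + v\<^sup>2) \<le> 0" using re by (simp add: power2_eq_square algebra_simps)
    then show False using small by simp
  qed
qed

lemma ray_distance_nonzero:
  assumes "norm \<omega> = 1" "cmod s * norm y < 1"
  shows "ray_distance \<omega> s y \<noteq> 0"
  using quadratic_notin_nonpos_Reals[OF assms] by (auto simp: ray_distance_def)

text \<open>
  The principal square root has nonnegative real part.
\<close>

lemma ray_distance_plus_1_nonzero: "ray_distance \<omega> s y + 1 \<noteq> 0"
proof
  assume "ray_distance \<omega> s y + 1 = 0"
  then have "Re (ray_distance \<omega> s y) = -1" by (simp add: add_eq_0_iff2)
  moreover have "0 \<le> Re (ray_distance \<omega> s y)" 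
    unfolding ray_distance_def by (metis csqrt_principal order_less_imp_le order_refl)
  ultimately show False by simp
qed

lemma ray_tensor_holomorphic:
  assumes "norm \<omega> = 1" and "\<kappa> \<noteq> 0"
  shows "(\<lambda>s. ray_tensor \<kappa> \<omega> s y $ i $ j) holomorphic_on {s. cmod s * norm y < 1}"
proof -
  have dist: "(\<lambda>s. ray_distance \<omega> s y) holomorphic_on {s. cmod s * norm y < 1}"
    unfolding ray_distance_def
    by (intro holomorphic_intros quadratic_notin_nonpos_Reals[OF assms(1)]) auto
  have phase: "(\<lambda>s. ray_phase \<omega> s y) holomorphic_on {s. cmod s * norm y < 1}"
    unfolding ray_phase_def using ray_distance_plus_1_nonzero
    by (intro holomorphic_intros dist) auto
  have u: "(\<lambda>s. s / ray_distance \<omega> s y) holomorphic_on {s. cmod s * norm y < 1}"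
    by (intro holomorphic_intros dist) (use ray_distance_nonzero[OF assms(1)] in auto)
  have v: "(\<lambda>s. (of_real (\<omega> $ k) - s * of_real (y $ k)) / ray_distance \<omega> s y)
      holomorphic_on {s. cmod s * norm y < 1}" for k
    by (intro holomorphic_intros dist) (use ray_distance_nonzero[OF assms(1)] in auto)
  show ?thesis
    unfolding ray_tensor_def vec_lambda_beta
    by (intro holomorphic_on_mult holomorphic_on_add holomorphic_on_diff holomorphic_on_divide
        holomorphic_on_power holomorphic_on_const holomorphic_on_exp' dist phase u v)
      (use ray_distance_nonzero[OF assms(1)] assms(2) in simp_all)
qed

lemma ray_tensor_continuous:
  assumes "norm \<omega> = 1" and "\<kappa> \<noteq> 0"
  shows "continuous_on {p. cmod (fst p) * norm (snd p) < 1}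
    (\<lambda>p. ray_tensor \<kappa> \<omega> (fst p) (snd p) $ i $ j)"
proof -
  let ?D = "{p :: complex \<times> (real^3). cmod (fst p) * norm (snd p) < 1}"
  have dist: "continuous_on ?D (\<lambda>p. ray_distance \<omega> (fst p) (snd p))"
    unfolding ray_distance_def
    by (intro continuous_on_compose2[OF continuous_on_csqrt] continuous_intros)
      (use quadratic_notin_nonpos_Reals[OF assms(1)] in auto)
  have phase: "continuous_on ?D (\<lambda>p. ray_phase \<omega> (fst p) (snd p))"
    unfolding ray_phase_def using ray_distance_plus_1_nonzero
    by (intro continuous_intros dist) auto
  have u: "continuous_on ?D (\<lambda>p. fst p / ray_distance \<omega> (fst p) (snd p))"
    by (intro continuous_intros dist) (use ray_distance_nonzero[OF assms(1)] in auto)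
  have v: "continuous_on ?D
      (\<lambda>p. (of_real (\<omega> $ k) - fst p * of_real (snd p $ k)) / ray_distance \<omega> (fst p) (snd p))" for k
    by (intro continuous_intros dist) (use ray_distance_nonzero[OF assms(1)] in auto)
  show ?thesis
    unfolding ray_tensor_def vec_lambda_beta
    by (intro continuous_on_mult continuous_on_add continuous_on_diff continuous_on_divide
        continuous_on_power continuous_on_const continuous_on_exp dist phase u v)
      (use ray_distance_nonzero[OF assms(1)] assms(2) in simp_all)
qed

lemma ray_tensor_continuous_y:
  assumes "norm \<omega> = 1" "\<kappa> \<noteq> 0" "\<And>y. y \<in> S \<Longrightarrow> cmod s * norm y < 1"
  shows "continuous_on S (\<lambda>y. ray_tensor \<kappa> \<omega> s y $ i $ j)"
proof -
  have "continuous_on S (\<lambda>y. ray_tensor \<kappa> \<omega> (fst (s, y)) (snd (s, y)) $ i $ j)"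
    by (rule continuous_on_compose2[OF ray_tensor_continuous[OF assms(1,2)]])
      (use assms(3) in \<open>auto intro!: continuous_intros\<close>)
  then show ?thesis by simp
qed

text \<open>
  All of the growth and oscillation at infinity sits in the scalar factor \<open>e\<^sup>i\<^sup>\<kappa>\<^sup>r/(4\<pi>r)\<close>; the remaining
  factor continues holomorphically through \<open>1/r = 0\<close>.
\<close>

lemma green_tensor_along_ray:
  assumes "norm \<omega> = 1" "r > 0" "norm y < r"
  shows "green_tensor \<kappa> (r *\<^sub>R \<omega>) y $ i $ j =
    exp (\<i> * \<kappa> * r) / (4 * pi * r) * ray_tensor \<kappa> \<omega> (of_real (1 / r)) y $ i $ j"
proof -
  define d D where "d = norm (r *\<^sub>R \<omega> - y)" and "D = complex_of_real (d / r)"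
  have neq: "r *\<^sub>R \<omega> \<noteq> y" using assms by auto
  then have "d > 0" by (simp add: d_def)
  have d2: "d\<^sup>2 = r\<^sup>2 - 2 * r * (\<omega> \<bullet> y) + (norm y)\<^sup>2"
  proof -
    have "d\<^sup>2 = (r *\<^sub>R \<omega> - y) \<bullet> (r *\<^sub>R \<omega> - y)"
      by (simp only: d_def power2_norm_eq_inner)
    also have "\<dots> = r\<^sup>2 * (\<omega> \<bullet> \<omega>) - 2 * r * (\<omega> \<bullet> y) + y \<bullet> y"
      by (simp add: inner_diff_left inner_diff_right inner_commute power2_eq_square)
    also have "\<omega> \<bullet> \<omega> = 1"
      using assms(1) by (simp add: norm_eq_1)
    finally show ?thesis by (simp add: power2_norm_eq_inner)
  qed
  have "(d / r)\<^sup>2 = 1 - 2 * (1 / r) * (\<omega> \<bullet> y) + (1 / r)\<^sup>2 * (norm y)\<^sup>2"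
    unfolding power_divide d2 using \<open>r > 0\<close> by (simp add: field_simps power2_eq_square)
  then have "complex_of_real ((d / r)\<^sup>2) = of_real (1 - 2 * (1 / r) * (\<omega> \<bullet> y) + (1 / r)\<^sup>2 * (norm y)\<^sup>2)"
    by (simp only:)
  then have radicand: "1 - 2 * of_real (1 / r) * of_real (\<omega> \<bullet> y)
      + (of_real (1 / r))\<^sup>2 * of_real ((norm y)\<^sup>2) = complex_of_real ((d / r)\<^sup>2)"
    by simp
  have dist: "ray_distance \<omega> (of_real (1 / r)) y = D"
  proof -
    have "ray_distance \<omega> (of_real (1 / r)) y = csqrt (of_real ((d / r)\<^sup>2))"
      unfolding ray_distance_def radicand by simp
    also have "\<dots> = of_real (sqrt ((d / r)\<^sup>2))"
      by (subst csqrt_of_real_nonneg) simp_all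
    also have "sqrt ((d / r)\<^sup>2) = d / r"
      using \<open>d > 0\<close> \<open>r > 0\<close> by simp
    finally show ?thesis by (simp add: D_def)
  qed
  have phase: "ray_phase \<omega> (of_real (1 / r)) y = of_real (d - r)"
  proof -
    have "((norm y)\<^sup>2 / r - 2 * (\<omega> \<bullet> y)) = (d - r) * (d / r + 1)"
      using d2 \<open>r > 0\<close> by (simp add: field_simps power2_eq_square)
    then have "complex_of_real ((norm y)\<^sup>2 / r - 2 * (\<omega> \<bullet> y)) = of_real ((d - r) * (d / r + 1))"
      by (simp only:)
    then have "of_real (1 / r) * of_real ((norm y)\<^sup>2) - 2 * of_real (\<omega> \<bullet> y) = of_real (d - r) * (D + 1)"
      by (simp add: D_def)
    then show ?thesis
      using ray_distance_plus_1_nonzero[of \<omega> "of_real (1 / r)" y]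
      unfolding ray_phase_def dist by simp
  qed
  have recip: "of_real (1 / r) / D = 1 / complex_of_real d"
    using \<open>r > 0\<close> by (simp add: D_def)
  have dir: "(of_real (\<omega> $ k) - of_real (1 / r) * of_real (y $ k)) / D
      = of_real ((r *\<^sub>R \<omega>) $ k - y $ k) / of_real d" for k
    using \<open>r > 0\<close> \<open>d > 0\<close> by (simp add: D_def field_simps)
  define g where "g = spherical_wave \<kappa> d"
  have "exp (\<i> * \<kappa> * r) * exp (\<i> * \<kappa> * of_real (d - r)) = exp (\<i> * of_real (\<kappa> * d))"
    by (simp add: exp_add[symmetric] algebra_simps)
  then have amplitude: "exp (\<i> * \<kappa> * r) / (4 * pi * r) * (exp (\<i> * \<kappa> * of_real (d - r)) / D) = g"
    using \<open>r > 0\<close> by (simp add: g_def spherical_wave_def D_def)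
  define k z where "k = complex_of_real \<kappa>" and "z = complex_of_real d"
  define a b where "a = complex_of_real ((r *\<^sub>R \<omega>) $ i - y $ i)"
    and "b = complex_of_real ((r *\<^sub>R \<omega>) $ j - y $ j)"
  define u v where "u = \<i> * k * (1 / z) - (1 / z)\<^sup>2"
    and "v = 3 / z ^ 4 - 3 * \<i> * k / z ^ 3 - k\<^sup>2 / z\<^sup>2"
  have "exp (\<i> * \<kappa> * r) / (4 * pi * r) * ray_tensor \<kappa> \<omega> (of_real (1 / r)) y $ i $ j =
     g * (of_bool (i = j) * (1 + (\<i> * k * (1 / z) - (1 / z)\<^sup>2) / k\<^sup>2)
      + (3 * (1 / z)\<^sup>2 - 3 * \<i> * k * (1 / z) - k\<^sup>2) / k\<^sup>2 * (a / z) * (b / z))"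
    unfolding ray_tensor_def vec_lambda_beta dist phase recip dir amplitude[symmetric] k_def z_def a_def b_def
    by (simp only: mult.assoc of_real_mult of_real_power of_real_numeral of_real_divide of_real_1)
  also have "(3 * (1 / z)\<^sup>2 - 3 * \<i> * k * (1 / z) - k\<^sup>2) / k\<^sup>2 * (a / z) * (b / z) = v / k\<^sup>2 * a * b"
  proof -
    have "(3 * (1 / z)\<^sup>2 - 3 * \<i> * k * (1 / z) - k\<^sup>2) / z\<^sup>2 = v"
      by (simp add: v_def diff_divide_distrib power_divide power2_eq_square power3_eq_cube
          power4_eq_xxxx mult.assoc)
    moreover have "p / k\<^sup>2 * (a / z) * (b / z) = p / z\<^sup>2 / k\<^sup>2 * a * b" for p
      by (simp add: power2_eq_square)
    ultimately show ?thesis by (simp only:)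
  qed
  also have "g * (of_bool (i = j) * (1 + (\<i> * k * (1 / z) - (1 / z)\<^sup>2) / k\<^sup>2) + v / k\<^sup>2 * a * b)
      = (if i = j then g + u * g / k\<^sup>2 else 0) + v * g / k\<^sup>2 * a * b"
    unfolding u_def[symmetric] by (simp add: distrib_left mult_ac)
  also have "u * g = wave_slope \<kappa> d"
    by (simp add: u_def k_def z_def g_def wave_slope_def power_divide)
  also have "v * g = wave_curvature \<kappa> d"
    by (simp add: v_def k_def z_def g_def wave_curvature_def)
  also have "(if i = j then g + wave_slope \<kappa> d / k\<^sup>2 else 0) + wave_curvature \<kappa> d / k\<^sup>2 * a * b
      = green_tensor \<kappa> (r *\<^sub>R \<omega>) y $ i $ j"
    unfolding green_tensor_nth[OF neq] d_def[symmetric] g_def a_def b_def k_def by simp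
  finally show ?thesis by simp
qed

section \<open>Holomorphic functions near infinity\<close>

text \<open>
  Differentiation under the integral sign. The dominating function on a closed disc controls the
  derivatives on the concentric disc of half the radius by Cauchy's inequality, hence also the
  difference quotients, and dominated convergence applies.
\<close>

lemma holomorphic_on_integral:
  fixes f :: "complex \<Rightarrow> 'a \<Rightarrow> complex"
  assumes "open S"
    and holo: "\<And>y. y \<in> space M \<Longrightarrow> (\<lambda>s. f s y) holomorphic_on S"
    and meas: "\<And>s. s \<in> S \<Longrightarrow> f s \<in> borel_measurable M"
    and dom: "\<And>z r. cball z r \<subseteq> S \<Longrightarrow> \<exists>g. integrable M g \<and> (\<forall>s\<in>cball z r. \<forall>y\<in>space M. cmod (f s y) \<le> g y)"
  shows "(\<lambda>s. \<integral>y. f s y \<partial>M) holomorphic_on S"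
  unfolding holomorphic_on_open[OF \<open>open S\<close>]
proof
  fix z assume "z \<in> S"
  then obtain e where "e > 0" and e: "cball z e \<subseteq> S"
    using \<open>open S\<close> open_contains_cball_eq by blast
  obtain g where g: "integrable M g"
    and bound: "\<And>s y. s \<in> cball z e \<Longrightarrow> y \<in> space M \<Longrightarrow> cmod (f s y) \<le> g y"
    using dom[OF e] by blast
  define d where "d = e / 2"
  have "d > 0" using \<open>e > 0\<close> by (simp add: d_def)
  define q where "q h y = (f (z + h) y - f z y) / h" for h y
  define D where "D y = deriv (\<lambda>s. f s y) z" for y
  have in_S: "z + h \<in> S" if "cmod h \<le> d" for h
    using that e \<open>d > 0\<close> by (auto simp: subset_iff dist_norm d_def)
  have q_lim: "((\<lambda>h. q h y) \<longlongrightarrow> D y) (at 0)" if "y \<in> space M" for y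
  proof -
    have "((\<lambda>s. f s y) has_field_derivative D y) (at z)"
      unfolding D_def by (rule holomorphic_derivI[OF holo[OF that] \<open>open S\<close> \<open>z \<in> S\<close>])
    then show ?thesis unfolding q_def DERIV_def .
  qed
  have q_bound: "cmod (q h y) \<le> g y / d" if "y \<in> space M" "h \<noteq> 0" "cmod h \<le> d" for h y
  proof -
    have deriv_bound: "cmod (deriv (\<lambda>s. f s y) w) \<le> g y / d" if "w \<in> cball z d" for w
    proof -
      have sub: "cball w d \<subseteq> cball z e"
      proof
        fix u assume "u \<in> cball w d"
        with that dist_triangle[of z u w] show "u \<in> cball z e" by (simp add: d_def)
      qed
      have "(\<lambda>s. f s y) holomorphic_on cball w d"
        using holo[OF \<open>y \<in> space M\<close>] sub e by (meson holomorphic_on_subset subset_trans)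
      then have "cmod ((deriv ^^ 1) (\<lambda>s. f s y) w) \<le> fact 1 * g y / d ^ 1"
        using sub \<open>y \<in> space M\<close> \<open>d > 0\<close>
        by (intro Cauchy_inequality)
          (auto intro: holomorphic_on_subset holomorphic_on_imp_continuous_on intro!: bound
            simp: dist_norm subset_iff)
      then show ?thesis by simp
    qed
    have "cmod (f (z + h) y - f z y) \<le> g y / d * cmod (z + h - z)"
    proof (rule field_differentiable_bound[where S = "cball z d" and f' = "deriv (\<lambda>s. f s y)"])
      fix w assume "w \<in> cball z d"
      then have "w \<in> S" using in_S[of "w - z"] by (simp add: dist_norm norm_minus_commute)
      show "((\<lambda>s. f s y) has_field_derivative deriv (\<lambda>s. f s y) w) (at w within cball z d)"
        using holomorphic_derivI[OF holo[OF \<open>y \<in> space M\<close>] \<open>open S\<close> \<open>w \<in> S\<close>]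
        by (rule has_field_derivative_at_within)
      show "cmod (deriv (\<lambda>s. f s y) w) \<le> g y / d" by (rule deriv_bound) fact
    qed (use that \<open>d > 0\<close> in \<open>auto simp: dist_norm\<close>)
    then show ?thesis using \<open>h \<noteq> 0\<close> by (simp add: q_def norm_divide divide_le_eq)
  qed
  have f_int: "integrable M (f s)" if "s \<in> cball z e" for s
    by (rule Bochner_Integration.integrable_bound[OF g meas])
      (use that e in \<open>auto intro!: AE_I2 order_trans[OF bound]\<close>)
  have "((\<lambda>h. \<integral>y. q h y \<partial>M) \<longlongrightarrow> (\<integral>y. D y \<partial>M)) (at 0)"
    unfolding tendsto_at_iff_sequentially comp_def
  proof (intro allI impI)
    fix X :: "nat \<Rightarrow> complex"
    assume X: "\<forall>n. X n \<in> UNIV - {0}" "X \<longlonglongrightarrow> 0"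
    have "\<forall>\<^sub>F n in sequentially. cmod (X n) < d"
      using tendstoD[OF X(2) \<open>d > 0\<close>] by (simp add: dist_norm)
    then obtain N where N: "\<And>n. n \<ge> N \<Longrightarrow> cmod (X n) < d"
      unfolding eventually_sequentially by blast
    have q_meas: "q (X (n + N)) \<in> borel_measurable M" for n
      unfolding q_def[abs_def] using meas[OF \<open>z \<in> S\<close>] meas[OF in_S[of "X (n + N)"]] N[of "n + N"]
      by (intro borel_measurable_divide borel_measurable_diff) auto
    have lim: "(\<lambda>n. q (X (n + N)) y) \<longlonglongrightarrow> D y" if "y \<in> space M" for y
    proof -
      have "(\<lambda>n. q (X n) y) \<longlonglongrightarrow> D y"
        using q_lim[OF that] X unfolding tendsto_at_iff_sequentially comp_def by blast
      then show ?thesis by (rule LIMSEQ_ignore_initial_segment)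
    qed
    have "(\<lambda>n. \<integral>y. q (X (n + N)) y \<partial>M) \<longlonglongrightarrow> (\<integral>y. D y \<partial>M)"
    proof (rule integral_dominated_convergence[where w = "\<lambda>y. g y / d"])
      show "D \<in> borel_measurable M"
        by (rule borel_measurable_LIMSEQ_metric[OF q_meas lim])
      show "AE y in M. cmod (q (X (n + N)) y) \<le> g y / d" for n
        using q_bound X(1) N[of "n + N"] by (auto intro!: AE_I2)
    qed (use q_meas lim g in auto)
    then show "(\<lambda>n. \<integral>y. q (X n) y \<partial>M) \<longlonglongrightarrow> (\<integral>y. D y \<partial>M)"
      by (rule LIMSEQ_offset)
  qed
  moreover have "\<forall>\<^sub>F h in at 0. (\<integral>y. q h y \<partial>M) = ((\<integral>y. f (z + h) y \<partial>M) - (\<integral>y. f z y \<partial>M)) / h"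
  proof -
    have "\<forall>\<^sub>F h in at (0 :: complex). cmod h < d"
      using eventually_at_ball[OF \<open>d > 0\<close>, of "0 :: complex" UNIV] by (simp add: dist_norm)
    then show ?thesis
    proof eventually_elim
      case (elim h)
      then have "integrable M (f (z + h))" "integrable M (f z)"
        using \<open>d > 0\<close> by (auto intro!: f_int simp: dist_norm d_def)
      then show ?case unfolding q_def by simp
    qed
  qed
  ultimately have "((\<lambda>s. \<integral>y. f s y \<partial>M) has_field_derivative (\<integral>y. D y \<partial>M)) (at z)"
    unfolding DERIV_def by (simp add: filterlim_cong)
  then show "\<exists>f'. ((\<lambda>s. \<integral>y. f s y \<partial>M) has_field_derivative f') (at z)" ..
qed

lemma analytic_continuation_from_interval:
  assumes "f holomorphic_on S" "open S" "connected S" "0 < \<delta>"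
    and "\<And>t. 0 < t \<Longrightarrow> t < \<delta> \<Longrightarrow> of_real t \<in> S" "\<And>t. 0 < t \<Longrightarrow> t < \<delta> \<Longrightarrow> f (of_real t) = 0"
    and "w \<in> S"
  shows "f w = 0"
proof (rule analytic_continuation[OF assms(1-3)])
  show "of_real ` {0<..<\<delta>} \<subseteq> S" "complex_of_real (\<delta> / 2) \<in> S"
    using assms(4) assms(5)[of "\<delta> / 2"] assms(5) by auto
  show "complex_of_real (\<delta> / 2) islimpt of_real ` {0<..<\<delta>}"
    unfolding islimpt_approachable
  proof (intro allI impI)
    fix e :: real assume "e > 0"
    define t where "t = \<delta> / 2 + min (e / 2) (\<delta> / 4)"
    have "t \<in> {0<..<\<delta>}" "t \<noteq> \<delta> / 2" "\<bar>t - \<delta> / 2\<bar> < e"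
      using \<open>e > 0\<close> \<open>0 < \<delta>\<close> by (auto simp: t_def min_def)
    moreover have "dist (complex_of_real t) (of_real (\<delta> / 2)) = \<bar>t - \<delta> / 2\<bar>"
      unfolding dist_norm of_real_diff[symmetric] norm_of_real ..
    ultimately show "\<exists>x'\<in>of_real ` {0<..<\<delta>}. x' \<noteq> complex_of_real (\<delta> / 2) \<and> dist x' (of_real (\<delta> / 2)) < e"
      by (metis imageI of_real_eq_iff)
  qed
qed (use assms in auto)

text \<open>
  Here \<open>s = 1/r\<close>, and \<open>e\<^sup>i\<^sup>c\<^sup>/\<^sup>s F = G\<close> expresses that an outgoing and an incoming wave agree. The
  exponential has an essential singularity at \<open>0\<close>: along \<open>s = it\<close> it equals \<open>e\<^sup>c\<^sup>/\<^sup>t\<close>, which no zero of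
  finite order of \<open>F\<close> can compensate, while \<open>G\<close> stays bounded.
\<close>

lemma outgoing_eq_incoming_imp_zero:
  assumes F: "F holomorphic_on ball 0 a" and G: "G holomorphic_on ball 0 a"
    and "0 < c" "0 < \<delta>" "\<delta> \<le> a"
    and eq: "\<And>t. 0 < t \<Longrightarrow> t < \<delta> \<Longrightarrow> exp (\<i> * of_real (c / t)) * F (of_real t) = G (of_real t)"
    and "w \<in> ball 0 a"
  shows "F w = 0"
proof (rule ccontr)
  assume "F w \<noteq> 0"
  have "a > 0" using assms by linarith
  have eq': "exp (\<i> * of_real c / s) * F s = G s" if "s \<in> ball 0 a - {0}" for s
  proof -
    have "exp (\<i> * of_real c / s) * F s - G s = 0"
    proof (rule analytic_continuation_from_interval[where f = "\<lambda>s. exp (\<i> * of_real c / s) * F s - G s"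
          and w = s and S = "ball 0 a - {0}" and \<delta> = \<delta>])
      show "(\<lambda>s. exp (\<i> * of_real c / s) * F s - G s) holomorphic_on ball 0 a - {0}"
        by (intro holomorphic_intros holomorphic_on_subset[OF F] holomorphic_on_subset[OF G]) auto
      show "connected (ball (0 :: complex) a - {0})"
        by (rule connected_punctured_ball) simp
    qed (use that eq \<open>0 < \<delta>\<close> \<open>\<delta> \<le> a\<close> in auto)
    then show ?thesis by simp
  qed
  \<comment> \<open>A nonzero holomorphic function vanishes at \<open>0\<close> to finite order only.\<close>
  have "\<exists>k n r. 0 < k \<and> 0 < r \<and> r \<le> a \<and> (\<forall>s \<in> ball 0 r. k * cmod s ^ n \<le> cmod (F s))"
  proof (cases "F 0 = 0")
    case True
    then have "0 \<in> ball 0 a" "F w \<noteq> F 0" using \<open>F w \<noteq> 0\<close> \<open>a > 0\<close> by auto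
    then show ?thesis
    proof (rule holomorphic_lower_bound_difference[OF F open_ball connected_ball _ \<open>w \<in> ball 0 a\<close>])
      fix k r :: real and n :: nat
      assume "0 < k" "0 < r" "ball (0 :: complex) r \<subseteq> ball 0 a"
        "\<And>s. s \<in> ball 0 r \<Longrightarrow> k * cmod (s - 0) ^ n \<le> cmod (F s - F 0)"
      then show ?thesis
        using True by (intro exI[of _ k] exI[of _ n] exI[of _ r]) (auto simp: ball_subset_ball_iff)
    qed
  next
    case False
    have "continuous (at 0) F"
      using F \<open>a > 0\<close> by (meson centre_in_ball continuous_on_eq_continuous_at
        holomorphic_on_imp_continuous_on open_ball)
    then obtain r where "r > 0" and near: "\<And>s. dist s 0 < r \<Longrightarrow> dist (F s) (F 0) < cmod (F 0) / 2"
      unfolding continuous_at_eps_delta using False by (meson half_gt_zero zero_less_norm_iff)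
    have "cmod (F 0) / 2 \<le> cmod (F s)" if "s \<in> ball 0 r" for s
      using near[of s] that norm_triangle_sub[of "F 0" "F s"]
      by (simp add: dist_norm norm_minus_commute)
    then show ?thesis
      using False \<open>a > 0\<close> \<open>r > 0\<close>
      by (intro exI[of _ "cmod (F 0) / 2"] exI[of _ 0] exI[of _ "min r a"]) auto
  qed
  then obtain k n r where k: "0 < k" and r: "0 < r" "r \<le> a"
    and low: "\<And>s. s \<in> ball 0 r \<Longrightarrow> k * cmod s ^ n \<le> cmod (F s)"
    by blast
  have "compact (G ` cball 0 (a / 2))"
    using G by (intro compact_continuous_image holomorphic_on_imp_continuous_on)
      (use \<open>a > 0\<close> in \<open>auto intro: holomorphic_on_subset\<close>)
  then obtain B where B: "\<And>s. s \<in> cball 0 (a / 2) \<Longrightarrow> cmod (G s) \<le> B"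
    by (meson bounded_iff compact_imp_bounded imageI)
  \<comment> \<open>The estimate on the imaginary half-axis that the growth of the exponential contradicts.\<close>
  have growth: "exp (c / t) * (k * t ^ n) \<le> B" if "0 < t" "t < r" "t < a / 2" for t
  proof -
    define s where "s = \<i> * complex_of_real t"
    have "cmod s = t" using that by (simp add: s_def norm_mult)
    have "\<i> * of_real c / s = of_real (c / t)" using that by (simp add: s_def)
    then have "cmod (exp (\<i> * of_real c / s)) = exp (c / t)" by (simp only: norm_exp_eq_Re Re_complex_of_real)
    have "exp (c / t) * (k * t ^ n) \<le> exp (c / t) * cmod (F s)"
      using low[of s] that \<open>cmod s = t\<close> by simp
    also have "\<dots> = cmod (G s)"
    proof -
      have "s \<in> ball 0 a - {0}" using that \<open>cmod s = t\<close> by auto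
      from eq'[OF this, symmetric] show ?thesis
        by (simp only: norm_mult \<open>cmod (exp _) = _\<close>)
    qed
    also have "\<dots> \<le> B" using B[of s] that \<open>cmod s = t\<close> by simp
    finally show ?thesis .
  qed
  have "filterlim (\<lambda>t. exp (c / t) * (k * t ^ n)) at_top (at_right 0)"
    using \<open>0 < c\<close> k by real_asymp
  then have "\<forall>\<^sub>F t in at_right 0. B < exp (c / t) * (k * t ^ n)"
    by (simp add: filterlim_at_top_dense)
  moreover have "\<forall>\<^sub>F t in at_right 0. t < r \<and> t < a / 2"
    unfolding eventually_at_right_field
    using r(1) \<open>a > 0\<close> by (intro exI[of _ "min r (a / 2)"]) auto
  ultimately have "\<forall>\<^sub>F t in at_right (0::real). False"
    using eventually_at_right_less[of 0] by eventually_elim (use growth in force)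
  then show False by simp
qed

section \<open>Integration over the support of the source\<close>

text \<open>
  The complement of the essential support is a union of open sets on each of which \<open>J\<close> vanishes almost
  everywhere; by Lindelof's theorem, countably many of them suffice.
\<close>

lemma AE_zero_outside_ess_support:
  assumes "S \<in> sets lebesgue"
  shows "AE y in lebesgue_on S. y \<notin> ess_support S J \<longrightarrow> J y = 0"
proof -
  define \<F> where "\<F> = {U. open U \<and> (AE y in lebesgue_on (S \<inter> U). J y = 0)}"
  have "\<And>U. U \<in> \<F> \<Longrightarrow> open U" by (simp add: \<F>_def)
  then obtain \<F>' where sub: "\<F>' \<subseteq> \<F>" and "countable \<F>'" and union: "\<Union>\<F>' = \<Union>\<F>"
    using Lindelof by metis
  have "AE y in lebesgue. y \<in> S \<inter> U \<longrightarrow> J y = 0" if "U \<in> \<F>'" for U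
  proof -
    have "open U" and null: "AE y in lebesgue_on (S \<inter> U). J y = 0"
      using that sub by (auto simp: \<F>_def)
    have "S \<inter> U \<in> sets lebesgue"
      using assms \<open>open U\<close> by (intro sets.Int) auto
    then show ?thesis
      using null AE_restrict_space_iff[of "S \<inter> U" lebesgue "\<lambda>y. J y = 0"] by simp
  qed
  then have "AE y in lebesgue. \<forall>U\<in>\<F>'. y \<in> S \<inter> U \<longrightarrow> J y = 0"
    using AE_ball_countable[OF \<open>countable \<F>'\<close>, of "\<lambda>y U. y \<in> S \<inter> U \<longrightarrow> J y = 0"] by blast
  moreover have "- ess_support S J = \<Union>\<F>'"
    unfolding union by (auto simp: ess_support_def \<F>_def)
  ultimately have "AE y in lebesgue. y \<in> S \<longrightarrow> y \<notin> ess_support S J \<longrightarrow> J y = 0"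
    by (auto elim!: eventually_mono)
  then show ?thesis
    using assms AE_restrict_space_iff[of S lebesgue] by simp
qed

text \<open>
  Kernels with complex \<open>s\<close> are controlled only for \<open>|y| \<le> \<rho>\<close>, so integrals over \<open>B\<^sub>R\<close> have to be moved to
  the smaller ball that carries the source.
\<close>

lemma
  fixes f :: "real^3 \<Rightarrow> complex"
  assumes S: "S \<in> sets lebesgue" and T: "T \<in> sets lebesgue" "T \<subseteq> S"
    and meas: "f \<in> borel_measurable (lebesgue_on S)"
    and zero: "AE y in lebesgue_on S. y \<notin> T \<longrightarrow> f y = 0"
  shows integrable_lebesgue_on_shrink: "integrable (lebesgue_on S) f \<longleftrightarrow> integrable (lebesgue_on T) f"
    and integral_lebesgue_on_shrink: "integral\<^sup>L (lebesgue_on S) f = integral\<^sup>L (lebesgue_on T) f"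
proof -
  have mS: "(\<lambda>y. indicator S y *\<^sub>R f y) \<in> borel_measurable lebesgue"
    using meas S by (simp add: borel_measurable_restrict_space_iff)
  have "(\<lambda>y. indicator T y *\<^sub>R (indicator S y *\<^sub>R f y)) \<in> borel_measurable lebesgue"
    by (rule borel_measurable_scaleR[OF borel_measurable_indicator[OF T(1)] mS])
  moreover have "indicat_real T y *\<^sub>R (indicat_real S y *\<^sub>R f y) = indicat_real T y *\<^sub>R f y" for y
    using T(2) by (cases "y \<in> T") auto
  ultimately have mT: "(\<lambda>y. indicator T y *\<^sub>R f y) \<in> borel_measurable lebesgue"
    by (simp only:)
  have ae: "AE y in lebesgue. indicator S y *\<^sub>R f y = indicator T y *\<^sub>R f y"
  proof -
    have "AE y in lebesgue. y \<in> S \<longrightarrow> y \<notin> T \<longrightarrow> f y = 0"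
      using zero S by (simp add: AE_restrict_space_iff)
    then show ?thesis
      by eventually_elim (use T(2) in \<open>auto simp: indicator_def\<close>)
  qed
  show "integrable (lebesgue_on S) f \<longleftrightarrow> integrable (lebesgue_on T) f"
    using integrable_cong_AE[OF mS mT ae] S T(1) by (simp add: integrable_restrict_space)
  show "integral\<^sup>L (lebesgue_on S) f = integral\<^sup>L (lebesgue_on T) f"
    using integral_cong_AE[OF mS mT ae] S T(1) by (simp add: integral_restrict_space)
qed

lemma L2_imp_integrable:
  assumes "f \<in> L2 S" "S \<in> lmeasurable"
  shows "integrable (lebesgue_on S) f"
proof (rule Bochner_Integration.integrable_bound)
  show "f \<in> borel_measurable (lebesgue_on S)" using assms(1) by (simp add: L2_def)
  have "integrable (lebesgue_on S) (\<lambda>y. (norm (f y))\<^sup>2)" using assms(1) by (simp add: L2_def)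
  moreover have "integrable (lebesgue_on S) (\<lambda>y. 1 :: real)"
    using assms(2) by (intro finite_measure.integrable_const) (simp add: finite_measure_lebesgue_on)
  ultimately show "integrable (lebesgue_on S) (\<lambda>y. 1 + (norm (f y))\<^sup>2)" by (rule Bochner_Integration.integrable_add[rotated])
  show "AE y in lebesgue_on S. norm (f y) \<le> norm (1 + (norm (f y))\<^sup>2)"
  proof (rule AE_I2)
    fix y
    have "0 \<le> (norm (f y) - 1)\<^sup>2" by simp
    then have "2 * norm (f y) \<le> 1 + (norm (f y))\<^sup>2" by (simp add: power2_diff)
    moreover have "norm (1 + (norm (f y))\<^sup>2) = 1 + (norm (f y))\<^sup>2" by simp
    ultimately show "norm (f y) \<le> norm (1 + (norm (f y))\<^sup>2)" using norm_ge_zero[of "f y"] by linarith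
  qed
qed

lemma integrable_vec:
  fixes f :: "'a \<Rightarrow> complex^3"
  assumes "\<And>i. integrable M (\<lambda>y. f y $ i)"
  shows "integrable M f"
proof -
  have "bounded_linear (axis i :: complex \<Rightarrow> complex^3)" for i
    unfolding linear_conv_bounded_linear[symmetric]
    by (rule linearI) (auto simp: axis_def vec_eq_iff)
  then have "integrable M (\<lambda>y. \<Sum>i\<in>UNIV. axis i (f y $ i))"
    by (intro Bochner_Integration.integrable_sum integrable_bounded_linear[where T = "axis _"] assms)
  moreover have "(\<Sum>i\<in>UNIV. axis i (f y $ i)) = f y" for y
  proof -
    have "(\<Sum>i\<in>UNIV. axis i (f y $ i)) $ k = (\<Sum>i\<in>UNIV. if k = i then f y $ i else 0)" for k
      unfolding sum_component axis_def by simp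
    then show ?thesis unfolding vec_eq_iff by simp
  qed
  ultimately show ?thesis by (simp only:)
qed

lemma integral_vec_nth:
  fixes f :: "'a \<Rightarrow> complex^3"
  assumes "\<And>i. integrable M (\<lambda>y. f y $ i)"
  shows "integral\<^sup>L M f $ i = (\<integral>y. f y $ i \<partial>M)"
  by (rule integral_bounded_linear[OF bounded_linear_vec_nth integrable_vec[OF assms], symmetric])

section \<open>The field along a ray\<close>

text \<open>
  The components of the field along the ray in direction \<open>\<omega>\<close>, without the factor \<open>e\<^sup>i\<^sup>\<kappa>\<^sup>r/(4\<pi>r)\<close>; the
  value at \<open>s = 0\<close> is, up to normalisation, the far field pattern.
\<close>

definition ray_field :: "real \<Rightarrow> real \<Rightarrow> (real^3 \<Rightarrow> complex^3) \<Rightarrow> real^3 \<Rightarrow> 3 \<Rightarrow> complex \<Rightarrow> complex" where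
  "ray_field \<kappa> \<rho> J \<omega> i s =
     (\<integral>y. (ray_tensor \<kappa> \<omega> s y *v J y) $ i \<partial>lebesgue_on (cball 0 \<rho>))"

lemma ray_field_reversal: "ray_field (-\<kappa>) \<rho> J \<omega> i s = ray_field \<kappa> \<rho> J (-\<omega>) i (-s)"
  unfolding ray_field_def ray_tensor_reversal ..

lemma ray_tensor_bounded:
  assumes "norm \<omega> = 1" "\<kappa> \<noteq> 0" "\<rho> > 0" "compact Z" "Z \<subseteq> ball 0 (1 / \<rho>)"
  obtains B where "\<And>s y j. s \<in> Z \<Longrightarrow> y \<in> cball 0 \<rho> \<Longrightarrow> cmod (ray_tensor \<kappa> \<omega> s y $ i $ j) \<le> B"
proof -
  have sub: "Z \<times> cball 0 \<rho> \<subseteq> {p :: complex \<times> (real^3). cmod (fst p) * norm (snd p) < 1}"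
  proof clarify
    fix s :: complex and y :: "real^3"
    assume "s \<in> Z" "y \<in> cball 0 \<rho>"
    then have "cmod s < 1 / \<rho>" "norm y \<le> \<rho>" using assms(5) by auto
    then have "cmod s * norm y \<le> cmod s * \<rho>" "cmod s * \<rho> < 1"
      using \<open>\<rho> > 0\<close> by (auto intro: mult_left_mono simp: pos_less_divide_eq)
    then show "cmod (fst (s, y)) * norm (snd (s, y)) < 1" by simp
  qed
  have "compact ((\<lambda>p. ray_tensor \<kappa> \<omega> (fst p) (snd p) $ i $ j) ` (Z \<times> cball 0 \<rho>))" for j
    by (intro compact_continuous_image continuous_on_subset[OF ray_tensor_continuous[OF assms(1,2)] sub]
        compact_Times assms compact_cball)
  then have "\<exists>B. \<forall>p\<in>Z \<times> cball 0 \<rho>. cmod (ray_tensor \<kappa> \<omega> (fst p) (snd p) $ i $ j) \<le> B" for j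
    by (meson bounded_iff compact_imp_bounded imageI)
  then obtain B where B: "\<And>j p. p \<in> Z \<times> cball 0 \<rho> \<Longrightarrow> cmod (ray_tensor \<kappa> \<omega> (fst p) (snd p) $ i $ j) \<le> B j"
    by metis
  have "cmod (ray_tensor \<kappa> \<omega> s y $ i $ j) \<le> Max (range B)" if "s \<in> Z" "y \<in> cball 0 \<rho>" for s y j
    using B[of "(s, y)" j] that by (auto intro: order_trans[OF _ Max_ge])
  then show ?thesis using that by blast
qed

lemma ray_integrand_measurable:
  assumes "norm \<omega> = 1" "\<kappa> \<noteq> 0" "S \<in> sets lebesgue" "\<And>y. y \<in> S \<Longrightarrow> cmod s * norm y < 1"
    and "\<And>j. (\<lambda>y. J y $ j) \<in> borel_measurable (lebesgue_on S)"
  shows "(\<lambda>y. (ray_tensor \<kappa> \<omega> s y *v J y) $ i) \<in> borel_measurable (lebesgue_on S)"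
  unfolding matrix_vector_mult_def vec_lambda_beta
  by (intro borel_measurable_sum borel_measurable_times assms(5)
      continuous_imp_measurable_on_sets_lebesgue[OF ray_tensor_continuous_y[OF assms(1,2,4)] assms(3)])

text \<open>
  On a compact set of parameters the kernel is bounded, uniformly over the support of the source, so a
  multiple of \<open>|J|\<close> dominates. A single parameter gives integrability, a closed disc of parameters
  gives holomorphy.
\<close>

lemma ray_integrand_dominated:
  assumes "norm \<omega> = 1" "\<kappa> \<noteq> 0" "\<rho> > 0" "compact Z" "Z \<subseteq> ball 0 (1 / \<rho>)"
    and J: "\<And>j. integrable (lebesgue_on (cball 0 \<rho>)) (\<lambda>y. J y $ j)"
  shows "\<exists>g. integrable (lebesgue_on (cball 0 \<rho>)) g \<and>
    (\<forall>s\<in>Z. \<forall>y\<in>cball 0 \<rho>. cmod ((ray_tensor \<kappa> \<omega> s y *v J y) $ i) \<le> g y)"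
proof -
  obtain B where B: "\<And>s y j. s \<in> Z \<Longrightarrow> y \<in> cball 0 \<rho> \<Longrightarrow> cmod (ray_tensor \<kappa> \<omega> s y $ i $ j) \<le> B"
    using ray_tensor_bounded[OF assms(1-5)] by metis
  have "cmod ((ray_tensor \<kappa> \<omega> s y *v J y) $ i) \<le> (\<Sum>j\<in>UNIV. B * cmod (J y $ j))"
    if "s \<in> Z" "y \<in> cball 0 \<rho>" for s y
    unfolding matrix_vector_mult_def vec_lambda_beta
    by (rule order_trans[OF norm_sum sum_mono]) (simp add: norm_mult mult_right_mono[OF B[OF that]])
  moreover have "integrable (lebesgue_on (cball 0 \<rho>)) (\<lambda>y. \<Sum>j\<in>UNIV. B * cmod (J y $ j))"
    using J by (intro Bochner_Integration.integrable_sum integrable_mult_right integrable_norm) auto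
  ultimately show ?thesis by blast
qed

lemma ray_field_holomorphic:
  assumes "norm \<omega> = 1" "\<kappa> \<noteq> 0" "\<rho> > 0"
    and J: "\<And>j. integrable (lebesgue_on (cball 0 \<rho>)) (\<lambda>y. J y $ j)"
  shows "ray_field \<kappa> \<rho> J \<omega> i holomorphic_on ball 0 (1 / \<rho>)"
  unfolding ray_field_def[abs_def]
proof (rule holomorphic_on_integral)
  have small: "cmod s * norm y < 1" if "s \<in> ball 0 (1 / \<rho>)" "y \<in> cball 0 \<rho>" for s and y :: "real^3"
  proof -
    have "cmod s * norm y \<le> cmod s * \<rho>" using that by (simp add: mult_left_mono)
    also have "\<dots> < 1" using that \<open>\<rho> > 0\<close> by (simp add: pos_less_divide_eq)
    finally show ?thesis .
  qed
  show "(\<lambda>s. (ray_tensor \<kappa> \<omega> s y *v J y) $ i) holomorphic_on ball 0 (1 / \<rho>)"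
    if "y \<in> space (lebesgue_on (cball 0 \<rho>))" for y
    unfolding matrix_vector_mult_def vec_lambda_beta
    by (intro holomorphic_intros holomorphic_on_subset[OF ray_tensor_holomorphic[OF assms(1,2)]])
      (use that small in auto)
  show "(\<lambda>y. (ray_tensor \<kappa> \<omega> s y *v J y) $ i) \<in> borel_measurable (lebesgue_on (cball 0 \<rho>))"
    if "s \<in> ball 0 (1 / \<rho>)" for s
    using J by (intro ray_integrand_measurable assms small that) auto
  show "\<exists>g. integrable (lebesgue_on (cball 0 \<rho>)) g \<and>
      (\<forall>s\<in>cball z r. \<forall>y\<in>space (lebesgue_on (cball 0 \<rho>)). cmod ((ray_tensor \<kappa> \<omega> s y *v J y) $ i) \<le> g y)"
    if "cball z r \<subseteq> ball 0 (1 / \<rho>)" for z r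
    using ray_integrand_dominated[OF assms(1-3) compact_cball that J] by simp
qed simp

lemma
  assumes "norm \<omega> = 1" "\<kappa> \<noteq> 0" "0 < \<rho>" "\<rho> < R" "R \<le> r"
    and J: "\<And>j. integrable (lebesgue_on (ball 0 R)) (\<lambda>y. J y $ j)"
    and zero: "AE y in lebesgue_on (ball 0 R). y \<notin> cball 0 \<rho> \<longrightarrow> J y = 0"
  shows green_integrand_integrable:
      "integrable (lebesgue_on (ball 0 R)) (\<lambda>y. (green_tensor \<kappa> (r *\<^sub>R \<omega>) y *v J y) $ i)"
    and electric_field_along_ray:
      "electric_field \<kappa> R J (r *\<^sub>R \<omega>) $ i =
        exp (\<i> * \<kappa> * r) / (4 * pi * r) * ray_field \<kappa> \<rho> J \<omega> i (of_real (1 / r))"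
proof -
  let ?f = "\<lambda>i y. (ray_tensor \<kappa> \<omega> (of_real (1 / r)) y *v J y) $ i"
  define c where "c = exp (\<i> * \<kappa> * r) / (4 * pi * r)"
  have r: "0 < r" "\<rho> < r" using assms by auto
  have sets: "ball 0 R \<in> sets lebesgue" "cball 0 \<rho> \<in> sets lebesgue" "cball 0 \<rho> \<subseteq> ball (0 :: real^3) R"
    using \<open>\<rho> < R\<close> by auto
  have meas: "?f i \<in> borel_measurable (lebesgue_on (ball 0 R))" for i
    using J r \<open>R \<le> r\<close> by (intro ray_integrand_measurable assms) (auto simp: norm_divide)
  have zero_f: "AE y in lebesgue_on (ball 0 R). y \<notin> cball 0 \<rho> \<longrightarrow> ?f i y = 0" for i
    using zero by eventually_elim auto
  have J_inner: "integrable (lebesgue_on (cball 0 \<rho>)) (\<lambda>y. J y $ j)" for j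
    by (rule integrable_lebesgue_on_shrink[OF sets, THEN iffD1])
      (use J zero in \<open>auto elim!: eventually_mono\<close>)
  have "integrable (lebesgue_on (cball 0 \<rho>)) (?f i)" for i
  proof -
    have *: "{of_real (1 / r)} \<subseteq> ball (0 :: complex) (1 / \<rho>)"
      using r \<open>0 < \<rho>\<close> by (simp add: norm_divide divide_strict_left_mono)
    obtain g where g: "integrable (lebesgue_on (cball 0 \<rho>)) g"
      and "\<forall>s\<in>{of_real (1 / r)}. \<forall>y\<in>cball 0 \<rho>. cmod ((ray_tensor \<kappa> \<omega> s y *v J y) $ i) \<le> g y"
      using ray_integrand_dominated[OF assms(1-3) compact_sing * J_inner] by blast
    then have bound: "\<And>y. y \<in> cball 0 \<rho> \<Longrightarrow> cmod (?f i y) \<le> g y" by blast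
    have "?f i \<in> borel_measurable (lebesgue_on (cball 0 \<rho>))"
      using J_inner r \<open>\<rho> < r\<close> by (intro ray_integrand_measurable assms) (auto simp: norm_divide)
    then show ?thesis
    proof (rule Bochner_Integration.integrable_bound[OF g], intro AE_I2)
      fix y :: "real^3" assume "y \<in> space (lebesgue_on (cball 0 \<rho>))"
      then have "cmod (?f i y) \<le> g y" by (intro bound) simp
      then show "cmod (?f i y) \<le> norm (g y)" by simp
    qed
  qed
  then have f_int: "integrable (lebesgue_on (ball 0 R)) (?f i)" for i
    using integrable_lebesgue_on_shrink[OF sets meas zero_f] by blast
  have green: "(green_tensor \<kappa> (r *\<^sub>R \<omega>) y *v J y) $ i = c * ?f i y" if "y \<in> ball 0 R" for i y
    using that assms r
    by (simp add: matrix_vector_mult_def green_tensor_along_ray c_def sum_distrib_left mult.assoc)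
  have green_int: "integrable (lebesgue_on (ball 0 R)) (\<lambda>y. (green_tensor \<kappa> (r *\<^sub>R \<omega>) y *v J y) $ i)" for i
    using integrable_mult_right[OF f_int, of c i]
    by (rule Bochner_Integration.integrable_cong[OF refl, THEN iffD1, rotated]) (simp add: green)
  show "integrable (lebesgue_on (ball 0 R)) (\<lambda>y. (green_tensor \<kappa> (r *\<^sub>R \<omega>) y *v J y) $ i)"
    by (rule green_int)
  have "electric_field \<kappa> R J (r *\<^sub>R \<omega>) $ i
      = (\<integral>y. (green_tensor \<kappa> (r *\<^sub>R \<omega>) y *v J y) $ i \<partial>lebesgue_on (ball 0 R))"
    unfolding electric_field_def by (rule integral_vec_nth[OF green_int])
  also have "\<dots> = (\<integral>y. c * ?f i y \<partial>lebesgue_on (ball 0 R))"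
    by (rule Bochner_Integration.integral_cong) (simp_all add: green)
  also have "\<dots> = c * integral\<^sup>L (lebesgue_on (ball 0 R)) (?f i)" by simp
  also have "\<dots> = c * ray_field \<kappa> \<rho> J \<omega> i (of_real (1 / r))"
    unfolding ray_field_def using integral_lebesgue_on_shrink[OF sets meas zero_f] by simp
  finally show "electric_field \<kappa> R J (r *\<^sub>R \<omega>) $ i =
      exp (\<i> * \<kappa> * r) / (4 * pi * r) * ray_field \<kappa> \<rho> J \<omega> i (of_real (1 / r))"
    by (simp only: c_def)
qed

section \<open>Nonradiating sources\<close>

theorem theorem3p9:
  fixes \<kappa> R :: real and J :: "real^3 \<Rightarrow> complex^3"
  assumes "\<kappa> > 0" and "R > 0"
    and "J \<in> L2_vec (ball 0 R)"
    and "compact (ess_support (ball 0 R) J)"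
    and "ess_support (ball 0 R) J \<subseteq> ball 0 R"
  shows "nonradiating \<kappa> R J \<longleftrightarrow> J \<in> null_space_N1 \<kappa> R"
proof -
  \<comment> \<open>The gap between \<open>\<rho>\<close> and \<open>R\<close> puts \<open>1/r\<close> inside the disc of holomorphy even for \<open>r = R\<close>.\<close>
  obtain \<rho> where \<rho>: "0 < \<rho>" "\<rho> < R" and supp: "ess_support (ball 0 R) J \<subseteq> cball 0 \<rho>"
  proof (cases "ess_support (ball 0 R) J = {}")
    case True
    then show ?thesis using that[of "R / 2"] \<open>R > 0\<close> by auto
  next
    case False
    then have "\<exists>y\<in>ess_support (ball 0 R) J. \<forall>z\<in>ess_support (ball 0 R) J. norm z \<le> norm y"
      by (intro continuous_attains_sup assms continuous_intros)
    then obtain y where "y \<in> ess_support (ball 0 R) J"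
      and max: "\<And>z. z \<in> ess_support (ball 0 R) J \<Longrightarrow> norm z \<le> norm y"
      by blast
    then have "norm y < R" using assms(5) by auto
    show ?thesis
    proof (rule that[of "max (norm y) (R / 2)"])
      show "ess_support (ball 0 R) J \<subseteq> cball 0 (max (norm y) (R / 2))"
        using max by (auto simp: le_max_iff_disj)
    qed (use \<open>norm y < R\<close> \<open>R > 0\<close> in auto)
  qed
  have zero: "AE y in lebesgue_on (ball 0 R). y \<notin> cball 0 \<rho> \<longrightarrow> J y = 0"
    using AE_zero_outside_ess_support[of "ball 0 R" J] supp by (auto elim!: eventually_mono)
  have J: "integrable (lebesgue_on (ball 0 R)) (\<lambda>y. J y $ j)" for j
    using assms(3) by (auto simp: L2_vec_def intro!: L2_imp_integrable)
  have J_inner: "integrable (lebesgue_on (cball 0 \<rho>)) (\<lambda>y. J y $ j)" for j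
    by (rule integrable_lebesgue_on_shrink[THEN iffD1, of "ball 0 R"])
      (use J zero \<rho> in \<open>auto elim!: eventually_mono\<close>)
  note E = electric_field_along_ray[OF _ _ \<rho> _ J zero]
  have holo: "ray_field k \<rho> J \<omega> i holomorphic_on ball 0 (1 / \<rho>)" if "norm \<omega> = 1" "k \<noteq> 0" for k \<omega> i
    by (rule ray_field_holomorphic[OF that \<rho>(1) J_inner])
  have recip: "of_real (1 / r) \<in> ball (0 :: complex) (1 / \<rho>)" if "R \<le> r" for r
  proof -
    have "0 < \<rho>" "\<rho> < r" using \<rho> that by auto
    then have "1 / r < 1 / \<rho>" by (intro divide_strict_left_mono) auto
    then show ?thesis using \<open>0 < \<rho>\<close> \<open>\<rho> < r\<close> by (simp add: norm_divide)
  qed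
  have disc: "of_real t \<in> ball (0 :: complex) (1 / \<rho>)" if "0 < t" "t < 1 / R" for t
    using recip[of "1 / t"] that \<open>R > 0\<close> by (simp add: field_simps)
  have polar: "\<exists>\<omega>. norm \<omega> = 1 \<and> x = norm x *\<^sub>R \<omega>" if "R \<le> norm x" for x :: "real^3"
  proof (intro exI conjI)
    have "x \<noteq> 0" using that \<open>R > 0\<close> by auto
    then show "norm (sgn x) = 1" "x = norm x *\<^sub>R sgn x" by (simp_all add: norm_sgn sgn_div_norm)
  qed
  have j0: "integral\<^sup>L (lebesgue_on (ball 0 R)) (\<lambda>y. j0_tensor \<kappa> x y *v J y) $ i =
      2 * pi / (\<i> * \<kappa>) * (electric_field \<kappa> R J x $ i - electric_field (-\<kappa>) R J x $ i)"
    if "R \<le> norm x" for x i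
  proof -
    obtain \<omega> where \<omega>: "norm \<omega> = 1" "x = norm x *\<^sub>R \<omega>" using polar[OF \<open>R \<le> norm x\<close>] by blast
    have int: "integrable (lebesgue_on (ball 0 R)) (\<lambda>y. (green_tensor k x y *v J y) $ i)"
      if "k \<noteq> 0" for k i
      using green_integrand_integrable[OF \<omega>(1) that \<rho> \<open>R \<le> norm x\<close> J zero] \<omega>(2) by simp
    have E_nth: "electric_field k R J x $ i = (\<integral>y. (green_tensor k x y *v J y) $ i \<partial>lebesgue_on (ball 0 R))"
      if "k \<noteq> 0" for k i
      unfolding electric_field_def by (rule integral_vec_nth[OF int[OF that]])
    have nth: "(j0_tensor \<kappa> x y *v J y) $ i = 2 * pi / (\<i> * \<kappa>) *
        ((green_tensor \<kappa> x y *v J y) $ i - (green_tensor (-\<kappa>) x y *v J y) $ i)" if "y \<in> ball 0 R" for y i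
    proof -
      have "x \<noteq> y" using that \<open>R \<le> norm x\<close> by auto
      then show ?thesis
        by (simp only: matrix_vector_mult_def vec_lambda_beta j0_tensor_nth[OF _ \<open>\<kappa> > 0\<close>] not_False_eq_True
          sum_distrib_left sum_subtractf[symmetric] left_diff_distrib right_diff_distrib mult.assoc)
    qed
    have j0_int: "integrable (lebesgue_on (ball 0 R)) (\<lambda>y. (j0_tensor \<kappa> x y *v J y) $ i)" for i
    proof -
      have "integrable (lebesgue_on (ball 0 R)) (\<lambda>y. 2 * pi / (\<i> * \<kappa>) *
          ((green_tensor \<kappa> x y *v J y) $ i - (green_tensor (-\<kappa>) x y *v J y) $ i))"
        using int \<open>\<kappa> > 0\<close> by (intro integrable_mult_right Bochner_Integration.integrable_diff) auto
      then show ?thesis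
        by (rule Bochner_Integration.integrable_cong[OF refl, THEN iffD1, rotated]) (simp add: nth)
    qed
    have "integral\<^sup>L (lebesgue_on (ball 0 R)) (\<lambda>y. j0_tensor \<kappa> x y *v J y) $ i
        = (\<integral>y. (j0_tensor \<kappa> x y *v J y) $ i \<partial>lebesgue_on (ball 0 R))"
      by (rule integral_vec_nth[OF j0_int])
    also have "\<dots> = (\<integral>y. 2 * pi / (\<i> * \<kappa>) *
          ((green_tensor \<kappa> x y *v J y) $ i - (green_tensor (-\<kappa>) x y *v J y) $ i) \<partial>lebesgue_on (ball 0 R))"
      by (rule Bochner_Integration.integral_cong) (simp_all add: nth)
    also have "\<dots> = 2 * pi / (\<i> * \<kappa>) * (electric_field \<kappa> R J x $ i - electric_field (-\<kappa>) R J x $ i)"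
      using \<open>\<kappa> > 0\<close> int by (simp add: E_nth)
    finally show ?thesis .
  qed
  \<comment> \<open>Only the values of \<open>ray_field\<close> for the wavenumbers \<open>\<kappa>\<close> and \<open>-\<kappa>\<close> matter from here on.\<close>
  show ?thesis
  proof
    assume nonrad: "nonradiating \<kappa> R J"
    have F0: "ray_field \<kappa> \<rho> J \<omega> i s = 0" if \<omega>: "norm \<omega> = 1" and s: "s \<in> ball 0 (1 / \<rho>)" for \<omega> i s
    proof (rule analytic_continuation_from_interval[OF holo[OF \<omega>] open_ball connected_ball _ disc _ s])
      fix t :: real assume t: "0 < t" "t < 1 / R"
      then have "R \<le> 1 / t" using \<open>R > 0\<close> by (simp add: field_simps)
      then have "electric_field \<kappa> R J ((1 / t) *\<^sub>R \<omega>) = 0"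
        using nonrad \<omega> t by (simp add: nonradiating_def)
      then show "ray_field \<kappa> \<rho> J \<omega> i (of_real t) = 0"
        using E[OF \<omega> _ \<open>R \<le> 1 / t\<close>, of \<kappa> i] \<open>\<kappa> > 0\<close> t by simp
    qed (use \<open>\<kappa> > 0\<close> \<open>R > 0\<close> in auto)
    have "integral\<^sup>L (lebesgue_on (ball 0 R)) (\<lambda>y. j0_tensor \<kappa> x y *v J y) $ i = 0"
      if "R < norm x" for x i
    proof -
      obtain \<omega> where \<omega>: "norm \<omega> = 1" "x = norm x *\<^sub>R \<omega>" using polar[of x] \<open>R < norm x\<close> by auto
      have s: "of_real (1 / norm x) \<in> ball (0 :: complex) (1 / \<rho>)" using recip that by simp
      then have s': "- of_real (1 / norm x) \<in> ball (0 :: complex) (1 / \<rho>)" by simp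
      have "electric_field \<kappa> R J (norm x *\<^sub>R \<omega>) $ i = 0"
        using E[OF \<omega>(1), of \<kappa> "norm x" i] F0[OF \<omega>(1) s] that \<open>\<kappa> > 0\<close> by simp
      \<comment> \<open>The incoming field in direction \<open>\<omega>\<close> is read off from \<open>F0\<close> in direction \<open>-\<omega>\<close>.\<close>
      moreover have "electric_field (-\<kappa>) R J (norm x *\<^sub>R \<omega>) $ i = 0"
        using E[OF \<omega>(1), of "-\<kappa>" "norm x" i] F0[OF _ s', of "-\<omega>"] \<omega>(1) that \<open>\<kappa> > 0\<close>
        by (simp add: ray_field_reversal)
      ultimately show ?thesis using j0[of x i] that \<omega>(2) by simp
    qed
    then show "J \<in> null_space_N1 \<kappa> R"
      using assms(3) by (simp add: null_space_N1_def vec_eq_iff)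
  next
    assume null: "J \<in> null_space_N1 \<kappa> R"
    have F0: "ray_field \<kappa> \<rho> J \<omega> i s = 0" if \<omega>: "norm \<omega> = 1" and s: "s \<in> ball 0 (1 / \<rho>)" for \<omega> i s
    proof (rule outgoing_eq_incoming_imp_zero[OF holo[OF \<omega>] holo[OF \<omega>, of "-\<kappa>"] _ _ _ _ s])
      show "0 < 2 * \<kappa>" "0 < 1 / R" "1 / R \<le> 1 / \<rho>"
        using \<open>\<kappa> > 0\<close> \<open>R > 0\<close> \<rho> by (auto simp: divide_left_mono)
      fix t :: real assume t: "0 < t" "t < 1 / R"
      define x where "x = (1 / t) *\<^sub>R \<omega>"
      have "R < 1 / t" using t \<open>R > 0\<close> by (simp add: field_simps)
      moreover have "norm x = 1 / t" using \<omega> t by (simp add: x_def)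
      ultimately have "R < norm x" by simp
      then have "integral\<^sup>L (lebesgue_on (ball 0 R)) (\<lambda>y. j0_tensor \<kappa> x y *v J y) $ i = 0"
        using null by (simp add: null_space_N1_def)
      then have "electric_field \<kappa> R J x $ i = electric_field (-\<kappa>) R J x $ i"
        using j0[of x i] \<open>R < norm x\<close> \<open>\<kappa> > 0\<close> by simp
      then have "exp (\<i> * of_real (\<kappa> / t)) * ray_field \<kappa> \<rho> J \<omega> i (of_real t)
          = exp (- (\<i> * of_real (\<kappa> / t))) * ray_field (-\<kappa>) \<rho> J \<omega> i (of_real t)"
        using E[OF \<omega>, of \<kappa> "1 / t" i] E[OF \<omega>, of "-\<kappa>" "1 / t" i] \<open>R < 1 / t\<close> \<open>\<kappa> > 0\<close> t
        by (simp add: x_def)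
      then have "exp (\<i> * of_real (\<kappa> / t)) * (exp (\<i> * of_real (\<kappa> / t)) * ray_field \<kappa> \<rho> J \<omega> i (of_real t))
          = exp (\<i> * of_real (\<kappa> / t)) * (exp (- (\<i> * of_real (\<kappa> / t))) * ray_field (-\<kappa>) \<rho> J \<omega> i (of_real t))"
        by (simp only:)
      then show "exp (\<i> * of_real (2 * \<kappa> / t)) * ray_field \<kappa> \<rho> J \<omega> i (of_real t)
          = ray_field (-\<kappa>) \<rho> J \<omega> i (of_real t)"
        unfolding mult.assoc[symmetric] exp_add[symmetric] by (simp add: algebra_simps)
    qed (use \<open>\<kappa> > 0\<close> in auto)
    show "nonradiating \<kappa> R J"
      unfolding nonradiating_def
    proof (intro allI impI)
      fix x :: "real^3" assume "x \<notin> ball 0 R"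
      then have "R \<le> norm x" by simp
      then obtain \<omega> where \<omega>: "norm \<omega> = 1" "x = norm x *\<^sub>R \<omega>" using polar by blast
      have s: "of_real (1 / norm x) \<in> ball (0 :: complex) (1 / \<rho>)"
        by (rule recip) fact
      have "electric_field \<kappa> R J (norm x *\<^sub>R \<omega>) $ i = 0" for i
        using E[OF \<omega>(1), of \<kappa> "norm x" i] F0[OF \<omega>(1) s] \<open>R \<le> norm x\<close> \<open>\<kappa> > 0\<close> by simp
      then show "electric_field \<kappa> R J x = 0" using \<omega>(2) by (simp add: vec_eq_iff)
    qed
  qed
qed

end
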